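(* Let $S\subseteq \mathbb{Z}^{+}$ and let $n\ge 0$ be an integer. Let $B_{n,S}(x)$ be the polynomial $$B_{n,S}(x)=\sum_{k=0}^n{n \brace k}_S x^k .$$ Then $$B_{n,S}(x)=\frac{1}{e^x}\sum_{\ell=0}^\infty f_{S,\ell}^{(n)}(0)\,\frac{x^\ell}{\ell!}.$$
   Context: $\mathbb{Z}^{+}$ is the set of positive integers. For $S\subseteq\mathbb{Z}^{+}$, ${n\brace k}_S$ denotes the number of partitions of $[n]=\{1,\dots,n\}$ into exactly $k$ (non-empty) blocks such that the size of each block belongs to $S$ (so ${0\brace 0}_S=1$). Put $E_S(x)=\sum_{s\in S}\frac{x^{s}}{s!}$ and, for $t$ a non-negative integer, $f_{S,t}(x)=(1+E_S(x))^t$. $f_{S,t}^{(n)}(0)$ denotes the $n$-th derivative of $f_{S,t}$ with respect to $x$ evaluated at $x=0$. *)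

theory Defs
  imports "HOL-Analysis.Analysis" "HOL-Computational_Algebra.Polynomial"
    "HOL-Library.Disjoint_Sets"
begin

definition S_partitions :: "nat set \<Rightarrow> nat \<Rightarrow> nat \<Rightarrow> nat set set set" where
  "S_partitions S n k =
     {P. partition_on {1..n} P \<and> card P = k \<and> (\<forall>b\<in>P. card b \<in> S)}"

definition S_stirling :: "nat set \<Rightarrow> nat \<Rightarrow> nat \<Rightarrow> nat" where
  "S_stirling S n k = card (S_partitions S n k)"

definition S_bell_poly :: "nat set \<Rightarrow> nat \<Rightarrow> 'a::comm_semiring_1 poly" where
  "S_bell_poly S n = (\<Sum>k=0..n. monom (of_nat (S_stirling S n k)) k)"

(* The family is absolutely summable for every x, so infsum never takes its
   default value here. *)
definition E_fun :: "nat set \<Rightarrow> 'a::{real_normed_field,banach} \<Rightarrow> 'a" where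
  "E_fun S x = (\<Sum>\<^sub>\<infinity>s\<in>S. x ^ s / fact s)"

definition f_fun :: "nat set \<Rightarrow> nat \<Rightarrow> 'a::{real_normed_field,banach} \<Rightarrow> 'a" where
  "f_fun S t x = (1 + E_fun S x) ^ t"

end

theory Submission
  imports Defs "HOL-Complex_Analysis.Laurent_Convergence"
begin

text \<open>
  Removing the block that contains a fixed element turns the count of \<open>S\<close>-partitions into the
  recurrence satisfied by the coefficients of the powers of \<open>E\<^sub>S\<close>, which comes from
  \<open>(E\<^sub>S\<^bsup>k+1\<^esup>)' = (k+1) E\<^sub>S\<^bsup>k\<^esup> E\<^sub>S'\<close>. Hence \<open>k! {n,k}\<^sub>S = n! [x\<^sup>n] E\<^sub>S\<^bsup>k\<^esup>\<close>. Expanding \<open>(1 + E\<^sub>S)\<^sup>l\<close>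
  binomially gives \<open>f\<^bsub>S,l\<^esub>\<^bsup>(n)\<^esup>(0) = \<Sum>\<^sub>k l(l-1)\<dots>(l-k+1) {n,k}\<^sub>S\<close>, a finite sum, and summing against
  \<open>x\<^sup>l / l!\<close> yields \<open>x\<^sup>k e\<^sup>x\<close> for each falling factorial.
\<close>

section \<open>Counting partitions by the block of a fixed element\<close>

text \<open>
  Arbitrary ground sets, because removing a block from \<open>{1..n}\<close> does not leave an initial segment.
\<close>
definition block_partitions :: "nat set \<Rightarrow> 'b set \<Rightarrow> nat \<Rightarrow> 'b set set set" where
  "block_partitions S A k = {P. partition_on A P \<and> card P = k \<and> (\<forall>b\<in>P. card b \<in> S)}"

lemma finite_block_partitions: "finite A \<Longrightarrow> finite (block_partitions S A k)"
  by (rule finite_subset[OF _ finitely_many_partition_on[of A]])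
    (auto simp: block_partitions_def)

text \<open>The block containing \<open>a\<close> has the form \<open>insert a B\<close>; deleting
  it leaves a partition of \<open>A - B\<close>, and putting it back reverses this.\<close>

lemma block_partitions_insert:
  assumes "finite A" "a \<notin> A"
  shows "block_partitions S (insert a A) (Suc k) =
    (\<Union>B\<in>{B\<in>Pow A. Suc (card B) \<in> S}. insert (insert a B) ` block_partitions S (A - B) k)"
    (is "?L = ?R")
proof (intro equalityI subsetI)
  fix P assume "P \<in> ?L"
  then have P: "partition_on (insert a A) P" "card P = Suc k" "\<forall>b\<in>P. card b \<in> S"
    by (auto simp: block_partitions_def)
  then obtain b where b: "b \<in> P" "a \<in> b"
    by (metis UnionE insertI1 partition_onD1)
  define B where "B = b - {a}"
  have bB: "b = insert a B" and aB: "a \<notin> B" using b by (auto simp: B_def)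
  have BA: "B \<subseteq> A" using partition_onD1[OF P(1)] b by (auto simp: B_def)
  have fB: "finite B" using BA assms(1) finite_subset by blast
  have disj: "disjnt b (\<Union>(P - {b}))"
    using partition_onD2[OF P(1)] b(1) by (auto simp: disjoint_def disjnt_iff)
  have Pb: "P = insert b (P - {b})" using b by auto
  have "insert a A - b = A - B" using assms(2) bB by auto
  then have "partition_on (A - B) (P - {b})"
    using partition_on_insert[OF disj, of "insert a A"] P(1) Pb by simp
  then have "P - {b} \<in> block_partitions S (A - B) k"
    using P b by (auto simp: block_partitions_def)
  moreover have "Suc (card B) \<in> S" using P(3) b(1) bB aB fB by auto
  ultimately show "P \<in> ?R" using BA Pb bB by blast
next
  fix P assume "P \<in> ?R"
  then obtain B Q where B: "B \<subseteq> A" "Suc (card B) \<in> S"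
    and Q: "partition_on (A - B) Q" "card Q = k" "\<forall>b\<in>Q. card b \<in> S"
    and P: "P = insert (insert a B) Q"
    by (auto simp: block_partitions_def)
  have fB: "finite B" using B assms(1) finite_subset by blast
  have disj: "disjnt (insert a B) (\<Union>Q)"
    using partition_onD1[OF Q(1)] assms(2) by (auto simp: disjnt_iff)
  have "insert a A - insert a B = A - B" using assms(2) by auto
  then have "partition_on (insert a A) P"
    using partition_on_insert[OF disj, of "insert a A"] Q(1) P B(1) by auto
  moreover have "finite Q"
    using Q(1) assms(1) finite_elements[of "A - B" Q] by auto
  moreover have "insert a B \<notin> Q" using partition_onD1[OF Q(1)] assms(2) by blast
  moreover have "a \<notin> B" using B(1) assms(2) by auto
  ultimately show "P \<in> ?L"
    using P Q B fB by (auto simp: block_partitions_def)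
qed

text \<open>The union above is disjoint, since a partition determines its block containing
  \<open>a\<close> and hence \<open>B\<close>. Each insertion map is injective because no block of a
  partition of \<open>A - B\<close> contains \<open>a\<close>.\<close>

lemma card_block_partitions_insert:
  assumes "finite A" "a \<notin> A"
  shows "card (block_partitions S (insert a A) (Suc k)) =
    (\<Sum>B\<in>{B\<in>Pow A. Suc (card B) \<in> S}. card (block_partitions S (A - B) k))"
proof -
  have notin: "insert a B \<notin> Q" if "Q \<in> block_partitions S (A - B) k" for B Q
    using that assms(2) partition_onD1[of "A - B" Q] by (auto simp: block_partitions_def)
  have inj: "inj_on (insert (insert a B)) (block_partitions S (A - B) k)" for B
    by (rule inj_onI) (metis insert_ident notin)
  have eq: "B = C" if "B \<subseteq> A" "C \<subseteq> A" "P \<in> insert (insert a B) ` block_partitions S (A - B) k"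
    "P \<in> insert (insert a C) ` block_partitions S (A - C) k" for B C P
  proof -
    have *: "{b \<in> P. a \<in> b} = {insert a D}"
      if "P \<in> insert (insert a D) ` block_partitions S (A - D) k" for D
      using that assms(2) partition_onD1[of "A - D"] by (fastforce simp: block_partitions_def)
    have "insert a B = insert a C" using *[OF that(3)] *[OF that(4)] by simp
    then show ?thesis using that(1,2) assms(2) by (metis insert_ident subsetD)
  qed
  show ?thesis
    unfolding block_partitions_insert[OF assms]
    using assms(1) eq
    by (subst card_UN_disjoint) (auto simp: finite_block_partitions card_image[OF inj])
qed

section \<open>Partition numbers as coefficients of powers of a formal series\<close>

lemma sum_Pow_card:
  fixes g :: "nat \<Rightarrow> 'a::comm_semiring_1"
  assumes "finite A"
  shows "(\<Sum>B\<in>Pow A. g (card B)) = (\<Sum>j=0..card A. of_nat (card A choose j) * g j)"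
proof -
  have "(\<Sum>B\<in>Pow A. g (card B)) = (\<Sum>j=0..card A. \<Sum>B\<in>{B \<in> Pow A. card B = j}. g (card B))"
    using assms by (intro sum.group[symmetric]) (auto intro: card_mono)
  also have "\<dots> = (\<Sum>j=0..card A. of_nat (card A choose j) * g j)"
    using n_subsets[OF assms] by (intro sum.cong) auto
  finally show ?thesis .
qed

text \<open>A formal counterpart of \<open>E_fun\<close>, over any field of characteristic 0, so
  that the counting involves no convergence.\<close>

definition E_fps :: "nat set \<Rightarrow> 'a::field_char_0 fps" where
  "E_fps S = Abs_fps (\<lambda>s. if s \<in> S then 1 / fact s else 0)"

lemma fps_nth_deriv_E_fps:
  "fps_nth (fps_deriv (E_fps S :: 'a::field_char_0 fps)) j = (if Suc j \<in> S then 1 / fact j else 0)"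
  by (simp add: E_fps_def del: of_nat_Suc)

text \<open>The induction is strong because the removed block may have any size. For empty
  \<open>A\<close>, the condition \<open>0 \<notin> S\<close> gives the series constant term 0, so
  its positive powers contribute nothing.\<close>

lemma card_block_partitions_eq_fps_nth:
  assumes "0 \<notin> S" "finite A"
  shows "fact k * of_nat (card (block_partitions S A k)) =
    fact (card A) * fps_nth (E_fps S ^ k :: 'a::field_char_0 fps) (card A)"
  using assms(2)
proof (induction "card A" arbitrary: A k rule: less_induct)
  case less
  show ?case
  proof (cases "A = {}")
    case True
    have "block_partitions S ({} :: 'b set) k = (if k = 0 then {{}} else {})"
      by (auto simp: block_partitions_def partition_on_empty)
    with True assms(1) show ?thesis by (simp add: fps_nth_power_0 E_fps_def)
  next
    case False
    then obtain a A' where A: "A = insert a A'" "a \<notin> A'" by (meson mk_disjoint_insert ex_in_conv)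
    have fin: "finite A'" using less.prems A by simp
    define m where "m = card A'"
    have cA: "card A = Suc m" using A fin by (simp add: m_def)
    show ?thesis
    proof (cases k)
      case 0
      have "block_partitions S A 0 = {}"
        using False less.prems finite_elements[of A]
        by (auto simp: block_partitions_def partition_on_def)
      with 0 show ?thesis by (simp add: cA)
    next
      case (Suc k')
      define F where "F = (E_fps S :: 'a fps)"
      \<comment> \<open>Here \<open>j\<close> counts the elements of the block other than
        \<open>a\<close>, leaving \<open>m - j\<close> elements. The value 0 for inadmissible sizes
        allows summation over all of \<open>Pow A'\<close>.\<close>
      define g :: "nat \<Rightarrow> 'a" where
        "g j = (if Suc j \<in> S then fact (m - j) * fps_nth (F ^ k') (m - j) else 0)" for j
      have "fact k' * of_nat (card (block_partitions S A k)) =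
        (\<Sum>B\<in>{B\<in>Pow A'. Suc (card B) \<in> S}. fact k' * of_nat (card (block_partitions S (A' - B) k')) :: 'a)"
        by (simp add: A Suc card_block_partitions_insert[OF fin A(2)] sum_distrib_left)
      also have "\<dots> = (\<Sum>B\<in>{B\<in>Pow A'. Suc (card B) \<in> S}. g (card B))"
      proof (intro sum.cong refl)
        fix B assume B: "B \<in> {B\<in>Pow A'. Suc (card B) \<in> S}"
        then have c: "card (A' - B) = m - card B"
          by (auto simp: m_def intro!: card_Diff_subset intro: finite_subset[OF _ fin])
        then have "card (A' - B) < card A" using cA by simp
        from less.hyps[OF this, of k'] fin B c
        show "fact k' * of_nat (card (block_partitions S (A' - B) k')) = g (card B)"
          by (simp add: g_def F_def)
      qed
      also have "\<dots> = (\<Sum>B\<in>Pow A'. g (card B))"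
        using fin by (intro sum.mono_neutral_left) (auto simp: g_def)
      also have "\<dots> = (\<Sum>j=0..m. of_nat (m choose j) * g j)"
        unfolding m_def by (rule sum_Pow_card[OF fin])
      \<comment> \<open>Since \<open>(m choose j) * fact (m - j) = fact m / fact j\<close>, a Cauchy
        product with the derivative of \<open>F\<close> appears.\<close>
      also have "\<dots> = fact m * (\<Sum>j=0..m. fps_nth (fps_deriv F) j * fps_nth (F ^ k') (m - j))"
        unfolding sum_distrib_left
        by (intro sum.cong) (auto simp: g_def F_def fps_nth_deriv_E_fps binomial_fact simp del: fps_deriv_nth)
      also have "\<dots> = fact m * fps_nth (fps_deriv F * F ^ k') m"
        by (simp only: fps_mult_nth)
      finally have *: "fact k' * of_nat (card (block_partitions S A k)) =
        fact m * fps_nth (fps_deriv F * F ^ k') m" .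
      \<comment> \<open>Differentiating the power supplies the factors \<open>Suc m\<close> and
        \<open>Suc k'\<close> that raise \<open>fact m\<close> and \<open>fact k'\<close> to the
        required factorials.\<close>
      have "of_nat (Suc m) * fps_nth (F ^ Suc k') (Suc m) = fps_nth (fps_deriv (F ^ Suc k')) m"
        by (simp only: fps_deriv_nth Suc_eq_plus1)
      also have "fps_deriv (F ^ Suc k') = fps_const (of_nat (Suc k')) * (fps_deriv F * F ^ k')"
        by (simp add: fps_deriv_power mult_ac del: of_nat_Suc power_Suc)
      finally have **: "of_nat (Suc m) * fps_nth (F ^ Suc k') (Suc m) =
        of_nat (Suc k') * fps_nth (fps_deriv F * F ^ k') m" by simp
      have "fact k * of_nat (card (block_partitions S A k)) =
        of_nat (Suc k') * (fact k' * of_nat (card (block_partitions S A k)) :: 'a)"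
        by (simp add: Suc mult_ac del: of_nat_Suc)
      also have "\<dots> = fact m * (of_nat (Suc k') * fps_nth (fps_deriv F * F ^ k') m)"
        unfolding * by (simp add: mult_ac)
      also have "\<dots> = fact (Suc m) * fps_nth (F ^ Suc k') (Suc m)"
        unfolding **[symmetric] by (simp add: mult_ac del: of_nat_Suc)
      finally show ?thesis by (simp add: cA Suc F_def)
    qed
  qed
qed

lemma S_stirling_eq_fps_nth:
  assumes "0 \<notin> S"
  shows "fact k * of_nat (S_stirling S n k) =
    fact n * fps_nth (E_fps S ^ k :: 'a::field_char_0 fps) n"
  using card_block_partitions_eq_fps_nth[OF assms, of "{1..n}" k]
  by (simp add: S_stirling_def S_partitions_def block_partitions_def)

text \<open>The series has zero constant term, so its \<open>k\<close>-th power has no terms below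
  degree \<open>k\<close>.\<close>

lemma S_stirling_eq_0:
  assumes "0 \<notin> S" "n < k"
  shows "S_stirling S n k = 0"
proof -
  have "fps_nth (E_fps S ^ k :: rat fps) n = 0"
    using assms by (intro startsby_zero_power_prefix[rule_format]) (auto simp: E_fps_def)
  with S_stirling_eq_fps_nth[OF assms(1), of k n, where 'a = rat] show ?thesis by simp
qed

section \<open>From the formal series to derivatives of \<open>f_fun\<close>\<close>

lemma norm_summable_E: "summable (\<lambda>s. norm (if s \<in> S then x ^ s / fact s else (0::'a::{real_normed_field,banach})))"
proof (rule summable_comparison_test')
  show "summable (\<lambda>s. norm (x ^ s /\<^sub>R fact s))" by (rule summable_norm_exp)
  show "norm (norm (if s \<in> S then x ^ s / fact s else 0)) \<le> norm (x ^ s /\<^sub>R fact s)" if "s \<ge> 0" for s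
    by (auto simp: norm_divide norm_mult norm_inverse divide_inverse mult.commute)
qed

text \<open>Absolute convergence makes the unordered sum over \<open>S\<close> agree with the
  ordered power series padded by zeros.\<close>

lemma E_fun_eq_eval_fps: "E_fun S x = eval_fps (E_fps S) x"
proof -
  let ?f = "\<lambda>s. if s \<in> S then x ^ s / fact s else 0"
  have "?f sums (\<Sum>s. ?f s)"
    by (rule summable_sums[OF summable_norm_cancel[OF norm_summable_E]])
  then have "(?f has_sum (\<Sum>s. ?f s)) UNIV"
    by (rule norm_summable_imp_has_sum[OF norm_summable_E])
  then have "infsum ?f UNIV = (\<Sum>s. ?f s)" by (rule infsumI)
  moreover have "E_fun S x = infsum ?f UNIV"
    unfolding E_fun_def by (rule infsum_cong_neutral) auto
  moreover have "(\<Sum>s. ?f s) = eval_fps (E_fps S) x"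
    unfolding eval_fps_def E_fps_def by (intro suminf_cong) simp
  ultimately show ?thesis by simp
qed

lemma fps_conv_radius_E_fps: "fps_conv_radius (E_fps S :: 'a::{real_normed_field,banach} fps) = \<infinity>"
  unfolding fps_conv_radius_def
proof (rule conv_radius_inftyI'')
  fix z :: 'a
  have "(\<lambda>n. fps_nth (E_fps S) n * z ^ n) = (\<lambda>s. if s \<in> S then z ^ s / fact s else 0)"
    by (auto simp: E_fps_def)
  then show "summable (\<lambda>n. fps_nth (E_fps S) n * z ^ n)"
    using summable_norm_cancel[OF norm_summable_E[of S z]] by simp
qed

lemma f_fun_has_fps_expansion: "f_fun S t has_fps_expansion (1 + E_fps S) ^ t"
proof -
  have "E_fun S has_fps_expansion E_fps S"
    by (simp add: has_fps_expansion_def fps_conv_radius_E_fps E_fun_eq_eval_fps)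
  then have "(\<lambda>x. (1 + E_fun S x) ^ t) has_fps_expansion (1 + E_fps S) ^ t"
    by (intro has_fps_expansion_power has_fps_expansion_add has_fps_expansion_1)
  then show ?thesis by (simp add: f_fun_def[abs_def])
qed

lemma higher_deriv_eq_fps_nth:
  fixes f :: "'a::{real_normed_field,banach} \<Rightarrow> 'a"
  assumes "f has_fps_expansion F"
  shows "(deriv ^^ n) f 0 = fact n * fps_nth F n"
  using assms
proof (induction n arbitrary: f F)
  case 0
  then show ?case
    using has_fps_expansion_imp_0_eq_fps_nth_0[OF 0] by simp
next
  case (Suc n)
  \<comment> \<open>The innermost derivative is split off, so that the induction hypothesis applies
    to \<open>deriv f\<close> and its expansion.\<close>
  have "(deriv ^^ Suc n) f 0 = (deriv ^^ n) (deriv f) 0"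
    by (simp only: funpow_Suc_right o_apply)
  also have "\<dots> = fact n * fps_nth (fps_deriv F) n"
    by (rule Suc.IH[OF has_fps_expansion_deriv[OF Suc.prems]])
  finally show ?case by (simp add: mult_ac)
qed

lemma higher_deriv_f_fun:
  assumes "0 \<notin> S"
  shows "(deriv ^^ n) (f_fun S l) (0::'a::{real_normed_field,banach}) =
    (\<Sum>k=0..n. of_nat (S_stirling S n k) * (of_nat (l choose k) * fact k))"
proof -
  let ?t = "\<lambda>k. of_nat (S_stirling S n k) * (of_nat (l choose k) * fact k) :: 'a"
  have "(deriv ^^ n) (f_fun S l) (0::'a) = fact n * fps_nth ((E_fps S + 1) ^ l) n"
    using higher_deriv_eq_fps_nth[OF f_fun_has_fps_expansion] by (simp add: add.commute)
  also have "(E_fps S + 1 :: 'a fps) ^ l = (\<Sum>k\<le>l. of_nat (l choose k) * E_fps S ^ k)"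
    by (subst binomial_ring) simp
  also have "fact n * fps_nth \<dots> n = (\<Sum>k\<le>l. of_nat (l choose k) * (fact n * fps_nth (E_fps S ^ k) n))"
    by (simp add: fps_sum_nth sum_distrib_left mult_ac flip: fps_of_nat)
  also have "\<dots> = (\<Sum>k\<le>l. ?t k)"
    by (simp add: mult_ac flip: S_stirling_eq_fps_nth[OF assms])
  \<comment> \<open>Terms with \<open>k > l\<close> vanish by the binomial coefficient, those with
    \<open>k > n\<close> by \<open>S_stirling_eq_0\<close>. The resulting range is independent of
    \<open>l\<close>, as needed for summing over \<open>l\<close>.\<close>
  also have "\<dots> = (\<Sum>k\<le>max l n. ?t k)"
    by (intro sum.mono_neutral_left) auto
  also have "\<dots> = (\<Sum>k=0..n. ?t k)"
    by (intro sum.mono_neutral_right) (auto simp: S_stirling_eq_0[OF assms])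
  finally show ?thesis .
qed

section \<open>Summing falling factorials against the exponential series\<close>

lemma sums_binomial_exp:
  fixes x :: "'a::{real_normed_field,banach}"
  shows "(\<lambda>l. of_nat (l choose k) * fact k * (x ^ l / fact l)) sums (x ^ k * exp x)"
proof -
  have "(\<lambda>i. x ^ k * (x ^ i /\<^sub>R fact i)) sums (x ^ k * exp x)"
    by (intro sums_mult exp_converges)
  \<comment> \<open>With \<open>l = i + k\<close>, the falling factorial
    \<open>(l choose k) * fact k\<close> divided by \<open>fact l\<close> is
    \<open>1 / fact i\<close>; the omitted terms \<open>l < k\<close> are zero.\<close>
  also have "(\<lambda>i. x ^ k * (x ^ i /\<^sub>R fact i)) =
    (\<lambda>i. of_nat ((i + k) choose k) * fact k * (x ^ (i + k) / fact (i + k)))"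
    by (simp add: binomial_fact scaleR_conv_of_real power_add field_simps)
  finally have "(\<lambda>i. of_nat ((i + k) choose k) * fact k * (x ^ (i + k) / fact (i + k)))
    sums (x ^ k * exp x)" .
  moreover have "(\<Sum>l<k. of_nat (l choose k) * fact k * (x ^ l / fact l)) = 0"
    by (intro sum.neutral) auto
  ultimately show ?thesis
    using sums_iff_shift[of "\<lambda>l. of_nat (l choose k) * fact k * (x ^ l / fact l)" k] by simp
qed

theorem theorem1:
  fixes S :: "nat set" and n :: nat and x :: "'a::{real_normed_field,banach}"
  assumes "S \<subseteq> {1..}"
  shows "summable (\<lambda>l. (deriv ^^ n) (f_fun S l) (0::'a) * (x ^ l / fact l)) \<and>
         poly (S_bell_poly S n) x =
           1 / exp x * (\<Sum>l. (deriv ^^ n) (f_fun S l) (0::'a) * (x ^ l / fact l))"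
proof -
  have 0: "0 \<notin> S" using assms by auto
  \<comment> \<open>The sum over \<open>k\<close> is finite, so it may be exchanged with the series
    over \<open>l\<close>.\<close>
  have "(\<lambda>l. \<Sum>k=0..n. of_nat (S_stirling S n k) * (of_nat (l choose k) * fact k * (x ^ l / fact l)))
    sums (\<Sum>k=0..n. of_nat (S_stirling S n k) * (x ^ k * exp x))"
    by (intro sums_sum sums_mult sums_binomial_exp)
  moreover have "(\<Sum>k=0..n. of_nat (S_stirling S n k) * (x ^ k * exp x)) =
    exp x * poly (S_bell_poly S n) x"
    by (simp add: S_bell_poly_def poly_sum poly_monom sum_distrib_left mult_ac)
  ultimately have "(\<lambda>l. (deriv ^^ n) (f_fun S l) (0::'a) * (x ^ l / fact l))
    sums (exp x * poly (S_bell_poly S n) x)"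
    by (simp only: higher_deriv_f_fun[OF 0] sum_distrib_right mult.assoc)
  then show ?thesis by (simp add: sums_iff)
qed

end
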